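(* Let $\rho^{AB}$ be a density operator on $\mathcal{H}_A\otimes\mathcal{H}_B$, and let $|\Psi\rangle^{ABE}\in\mathcal{H}_A\otimes\mathcal{H}_B\otimes\mathcal{H}_E$ be a purification of it, i.e. a unit vector with $\mathrm{Tr}_E|\Psi\rangle\langle\Psi|=\rho^{AB}$. If $D(A|B)=S(B)$, then the measured subsystem $B$ is uncorrelated with the environment $E$, that is, $\rho^{EB}=\rho^E\otimes\rho^B$, where $\rho^{EB},\rho^E,\rho^B$ are the reduced states of $|\Psi\rangle\langle\Psi|$.
   Context: All Hilbert spaces are finite-dimensional complex Hilbert spaces. A state is a density operator (positive semidefinite, trace one). Superscripts denote reduced states. The von Neumann entropy is $S(X)=-\mathrm{Tr}\,\rho^X\log_2\rho^X$. The mutual information is $I(A:B)=S(A)+S(B)-S(AB)$. The classical correlation (with measurement on $B$) is $$J(A|B)=\max_{\{E_i^B\}}\Big(S(A)-\sum_i p_i\,S(A|E_i^B)\Big),$$ where the maximum is over all POVMs $\{E_i^B\}$ on $\mathcal{H}_B$, $p_i=\mathrm{Tr}\big((I\otimes E_i^B)\rho^{AB}\big)$, and $S(A|E_i^B)$ is the von Neumann entropy of the post-measurement state $\rho_i^A=\mathrm{Tr}_B\big((I\otimes E_i^B)\rho^{AB}\big)/p_i$ (terms with $p_i=0$ are omitted). The quantum discord (with measurement on $B$) is $D(A|B)=I(A:B)-J(A|B)$. *)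

theory Defs
  imports "HOL-Analysis.Analysis"
begin

text \<open>
  A finite-dimensional Hilbert space with a fixed orthonormal basis indexed by the finite type
  \<open>'n\<close> is \<open>complex ^ 'n\<close>; the tensor product of the spaces indexed by \<open>'m\<close> and \<open>'n\<close> is indexed
  by \<open>'m \<times> 'n\<close>. Operators are square matrices, \<open>M $ i $ j\<close> being row \<open>i\<close>, column \<open>j\<close>.
\<close>

type_synonym 'n cmat = "complex ^ 'n ^ 'n"

definition dagger :: "'n::finite cmat \<Rightarrow> 'n cmat" where
  "dagger M = (\<chi> i j. cnj (M $ j $ i))"

definition unitary_mat :: "'n::finite cmat \<Rightarrow> bool" where
  "unitary_mat U \<longleftrightarrow> U ** dagger U = mat 1 \<and> dagger U ** U = mat 1"

definition cdiag :: "real ^ 'n::finite \<Rightarrow> 'n cmat" where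
  "cdiag d = (\<chi> i j. if i = j then complex_of_real (d $ i) else 0)"

definition psd :: "'n::finite cmat \<Rightarrow> bool" where
  "psd M \<longleftrightarrow> dagger M = M \<and> (\<forall>x. 0 \<le> Re (\<Sum>i\<in>UNIV. cnj (x $ i) * (M *v x) $ i))"

definition density_op :: "'n::finite cmat \<Rightarrow> bool" where
  "density_op \<rho> \<longleftrightarrow> psd \<rho> \<and> trace \<rho> = 1"

text \<open>
  Functional calculus of a Hermitian matrix. The result does not depend on the chosen
  diagonalisation, so \<open>THE\<close> is well defined for every Hermitian \<open>M\<close>.
\<close>

definition herm_fun :: "(real \<Rightarrow> real) \<Rightarrow> 'n::finite cmat \<Rightarrow> 'n cmat" where
  "herm_fun f M = (THE N. \<exists>U d. unitary_mat U \<and> M = U ** cdiag d ** dagger U \<and>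
     N = U ** cdiag (\<chi> i. f (d $ i)) ** dagger U)"

text \<open>
  On the kernel of \<open>\<rho>\<close> the finite value of \<open>log 2 0\<close> is multiplied by the eigenvalue \<open>0\<close>, which is
  the usual convention \<open>0 log 0 = 0\<close>.
\<close>

definition vn_entropy :: "'n::finite cmat \<Rightarrow> real" where
  "vn_entropy \<rho> = - Re (trace (\<rho> ** herm_fun (log 2) \<rho>))"

definition tensor :: "'m::finite cmat \<Rightarrow> 'n::finite cmat \<Rightarrow> ('m \<times> 'n) cmat"  (infixr "\<otimes>\<^sub>m" 75) where
  "M \<otimes>\<^sub>m N = (\<chi> i j. M $ fst i $ fst j * N $ snd i $ snd j)"

text \<open>Partial traces over the first and over the second tensor factor.\<close>

definition ptrace1 :: "('m::finite \<times> 'n::finite) cmat \<Rightarrow> 'n cmat" where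
  "ptrace1 M = (\<chi> i j. \<Sum>k\<in>UNIV. M $ (k, i) $ (k, j))"

definition ptrace2 :: "('m::finite \<times> 'n::finite) cmat \<Rightarrow> 'm cmat" where
  "ptrace2 M = (\<chi> i j. \<Sum>k\<in>UNIV. M $ (i, k) $ (j, k))"

definition mutual_info :: "('a::finite \<times> 'b::finite) cmat \<Rightarrow> real" where
  "mutual_info \<rho> = vn_entropy (ptrace2 \<rho>) + vn_entropy (ptrace1 \<rho>) - vn_entropy \<rho>"

text \<open>A POVM with \<open>n\<close> outcomes; only the values \<open>E i\<close> with \<open>i < n\<close> matter.\<close>

definition povm :: "nat \<Rightarrow> (nat \<Rightarrow> 'b::finite cmat) \<Rightarrow> bool" where
  "povm n E \<longleftrightarrow> (\<forall>i<n. psd (E i)) \<and> (\<Sum>i<n. E i) = mat 1"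

definition outcome_prob :: "('a::finite \<times> 'b::finite) cmat \<Rightarrow> 'b cmat \<Rightarrow> real" where
  "outcome_prob \<rho> F = Re (trace ((mat 1 \<otimes>\<^sub>m F) ** \<rho>))"

definition post_state :: "('a::finite \<times> 'b::finite) cmat \<Rightarrow> 'b cmat \<Rightarrow> 'a cmat" where
  "post_state \<rho> F = (1 / outcome_prob \<rho> F) *\<^sub>R ptrace2 ((mat 1 \<otimes>\<^sub>m F) ** \<rho>)"

definition measured_info ::
    "('a::finite \<times> 'b::finite) cmat \<Rightarrow> nat \<Rightarrow> (nat \<Rightarrow> 'b cmat) \<Rightarrow> real" where
  "measured_info \<rho> n E = vn_entropy (ptrace2 \<rho>) -
     (\<Sum>i | i < n \<and> outcome_prob \<rho> (E i) \<noteq> 0.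
        outcome_prob \<rho> (E i) * vn_entropy (post_state \<rho> (E i)))"

text \<open>
  The maximum over all POVMs is written as a supremum: for a state \<open>\<rho>\<close> the set is nonempty and
  bounded above by the entropy of the first factor, and the supremum is the maximum when attained.
\<close>

definition classical_corr :: "('a::finite \<times> 'b::finite) cmat \<Rightarrow> real" where
  "classical_corr \<rho> = Sup {measured_info \<rho> n E | n E. povm n E}"

definition discord :: "('a::finite \<times> 'b::finite) cmat \<Rightarrow> real" where
  "discord \<rho> = mutual_info \<rho> - classical_corr \<rho>"

definition ketbra :: "complex ^ 'n::finite \<Rightarrow> 'n cmat" where
  "ketbra \<psi> = (\<chi> i j. \<psi> $ i * cnj (\<psi> $ j))"

text \<open>
  The tripartite space is indexed by \<open>('a \<times> 'b) \<times> 'e\<close>. The reduced operator on the environment and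
  the second system is obtained by tracing out the first system, listing the environment first.
\<close>

definition purification ::
    "complex ^ (('a::finite \<times> 'b::finite) \<times> 'e::finite) \<Rightarrow> ('a \<times> 'b) cmat \<Rightarrow> bool" where
  "purification \<Psi> \<rho> \<longleftrightarrow> norm \<Psi> = 1 \<and> ptrace2 (ketbra \<Psi>) = \<rho>"

definition reduced_EB ::
    "(('a::finite \<times> 'b::finite) \<times> 'e::finite) cmat \<Rightarrow> ('e \<times> 'b) cmat" where
  "reduced_EB M = (\<chi> i j. \<Sum>a\<in>UNIV. M $ ((a, snd i), fst i) $ ((a, snd j), fst j))"

definition reduced_E ::
    "(('a::finite \<times> 'b::finite) \<times> 'e::finite) cmat \<Rightarrow> 'e cmat" where
  "reduced_E M = ptrace1 M"

definition reduced_B ::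
    "(('a::finite \<times> 'b::finite) \<times> 'e::finite) cmat \<Rightarrow> 'b cmat" where
  "reduced_B M = ptrace1 (ptrace2 M)"

end

theory Submission imports Defs begin

text \<open>
  Maximal discord means that no POVM on \<open>B\<close> lowers the average entropy of \<open>A\<close> below \<open>S(AB) = S(E)\<close>.
  If all elements of the POVM have rank one, the states of \<open>AE\<close> after the measurement are pure, so
  the entropies of \<open>A\<close> may be replaced by those of \<open>E\<close>, whose states average to \<open>\<rho>\<^sup>E\<close>. Strict concavity
  of the entropy then forces all of them to be equal to \<open>\<rho>\<^sup>E\<close>. Hence
  \<open>Tr\<^sub>B ((I \<otimes> H) \<rho>\<^sup>E\<^sup>B) = Tr (H \<rho>\<^sup>B) \<rho>\<^sup>E\<close> for every Hermitian \<open>H\<close>, on measuring in an eigenbasis of \<open>H\<close>,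
  and Hermitian matrices separate points.
\<close>

section \<open>Diagonalisation of Hermitian matrices\<close>

text \<open>The passage from discord to an entropy inequality is arithmetic: D = S(A) + S(B) - S(AB)
  - J, so D = S(B) says J = S(A) - S(AB), and every measured information is at most J. That bound on
  a supremum needs the set to be bounded above, which nonnegativity of the entropy provides. Strict
  concavity with its equality case comes from Klein's inequality. Singular spectra shape the
  details. At zero eigenvalues of the average the logarithm says nothing, so the diagonal entries of
  each component there must be shown to vanish. For outcomes of probability zero no normalised state
  exists, so the states of E are kept unnormalised; they vanish together with their trace.\<close>

definition adj :: "complex ^ 'n::finite ^ 'm::finite \<Rightarrow> complex ^ 'm ^ 'n" where
  "adj M = (\<chi> i j. cnj (M $ j $ i))"

definition cip :: "complex ^ 'n::finite \<Rightarrow> complex ^ 'n \<Rightarrow> complex" where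
  "cip x y = (\<Sum>i\<in>UNIV. cnj (x $ i) * y $ i)"

text \<open>\<open>dagger\<close> is typed for square matrices only. Coefficient matrices of
  bipartite vectors are rectangular, hence the more general \<open>adj\<close>.\<close>

lemma dagger_eq_adj: "dagger = adj"
  by (auto simp: dagger_def adj_def)

lemma adj_nth [simp]: "adj M $ i $ j = cnj (M $ j $ i)"
  by (simp add: adj_def)

lemma adj_adj [simp]: "adj (adj M) = M"
  by (simp add: vec_eq_iff)

lemma adj_mult: "adj (A ** B) = adj B ** adj A"
  by (simp add: vec_eq_iff matrix_matrix_mult_def mult.commute)

lemma cip_add_right: "cip x (y + z) = cip x y + cip x z"
  by (simp add: cip_def algebra_simps sum.distrib)

lemma cip_scale_right: "cip x (c *s y) = c * cip x y"
  by (simp add: cip_def algebra_simps sum_distrib_left)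

lemma cnj_cip: "cnj (cip x y) = cip y x"
  by (simp add: cip_def mult.commute)

lemma cip_scale_left: "cip (c *s y) x = cnj c * cip y x"
  by (simp add: cip_def algebra_simps sum_distrib_left)

text \<open>This gives access to the real Euclidean structure: dimension counts, compactness and
  orthogonal complements are all taken there.\<close>

lemma Re_cip: "Re (cip x y) = x \<bullet> y"
  by (simp add: cip_def inner_vec_def inner_complex_def)

lemma cip_self: "cip x x = of_real ((norm x)\<^sup>2)"
proof (rule complex_eqI)
  show "Re (cip x x) = Re (of_real ((norm x)\<^sup>2))"
    by (simp only: Re_cip Re_complex_of_real power2_norm_eq_inner)
  show "Im (cip x x) = Im (of_real ((norm x)\<^sup>2))"
    by (simp add: cip_def mult.commute)
qed

lemma cip_adj: "cip x (M *v y) = cip (adj M *v x) y"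
  for M :: "complex ^ 'n::finite ^ 'm::finite"
proof -
  have "cip x (M *v y) = (\<Sum>i\<in>UNIV. \<Sum>j\<in>UNIV. cnj (x $ i) * (M $ i $ j * y $ j))"
    by (simp add: cip_def matrix_vector_mult_def sum_distrib_left)
  also have "\<dots> = (\<Sum>j\<in>UNIV. \<Sum>i\<in>UNIV. cnj (x $ i) * (M $ i $ j * y $ j))"
    by (rule sum.swap)
  also have "\<dots> = cip (adj M *v x) y"
    by (simp add: cip_def matrix_vector_mult_def sum_distrib_left sum_distrib_right ac_simps)
  finally show ?thesis .
qed

lemma cscale_eq_scaleR: "of_real r *s x = r *\<^sub>R (x :: complex ^ 'n)"
  by (simp add: vec_eq_iff scaleR_conv_of_real[of _ "_ :: complex"])

lemma cmat_vector_scaleR: "M *v (r *\<^sub>R x) = r *\<^sub>R (M *v x)"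
  for x :: "complex ^ 'n::finite"
  by (simp only: cscale_eq_scaleR[symmetric] vector_scalar_commute)

lemma continuous_on_quadratic_form: "continuous_on S (\<lambda>x. Re (cip x (M *v x)))"
  unfolding Re_cip matrix_vector_mult_def inner_vec_def
  by (intro continuous_intros)

text \<open>First-order condition at a maximum: for small \<open>t\<close> of the sign of
  \<open>a\<close> the linear term wins. The choice \<open>t = a / s\<close> with
  \<open>s > \<bar>b\<bar>\<close> makes the expression at least
  \<open>a\<^sup>2 / s\<close>.\<close>

lemma quadratic_nonpos_imp_linear_zero:
  fixes a b :: real
  assumes "\<And>t. 2 * t * a + t\<^sup>2 * b \<le> 0"
  shows "a = 0"
proof (rule ccontr)
  assume "a \<noteq> 0"
  define s where "s = \<bar>b\<bar> + 1"
  define t where "t = a / s"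
  have "s > 0" by (simp add: s_def)
  have "2 * t * a + t\<^sup>2 * b \<ge> 2 * t * a - t\<^sup>2 * s"
    unfolding s_def by (smt (verit) abs_ge_minus_self mult_minus_right mult_left_mono zero_le_power2)
  moreover have "2 * t * a - t\<^sup>2 * s = a\<^sup>2 / s"
    using \<open>s > 0\<close> by (simp add: t_def field_simps power2_eq_square)
  moreover have "a\<^sup>2 / s > 0"
    using \<open>a \<noteq> 0\<close> \<open>s > 0\<close> by simp
  ultimately show False
    using assms[of t] by linarith
qed

text \<open>A count of real dimensions: the vectors \<open>u i\<close> and
  \<open>\<i> *s u i\<close> span at most twice \<open>card I\<close> real dimensions, fewer than
  the whole space has. Real orthogonality to both kills the real and the imaginary part of
  \<open>cip (u i) x\<close>.\<close>

lemma exists_orthogonal_unit_vector: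
  fixes u :: "'n::finite \<Rightarrow> complex ^ 'n"
  assumes "I \<noteq> UNIV"
  shows "\<exists>x. norm x = 1 \<and> (\<forall>i\<in>I. cip (u i) x = 0)"
proof -
  define S where "S = u ` I \<union> (\<lambda>i. \<i> *s u i) ` I"
  have "card I < CARD('n)"
    using assms by (simp add: psubset_card_mono psubsetI)
  moreover have "card S \<le> card I + card I"
    unfolding S_def by (intro order.trans[OF card_Un_le] add_mono card_image_le) auto
  moreover have "dim S \<le> card S"
    by (rule dim_le_card') (simp add: S_def)
  ultimately have "dim S < DIM(complex ^ 'n)"
    by simp
  then obtain x where x: "x \<noteq> 0" "\<And>y. y \<in> span S \<Longrightarrow> orthogonal x y"
    using orthogonal_to_subspace_exists by blast
  define z where "z = (1 / norm x) *\<^sub>R x"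
  have "cip (u i) z = 0" if "i \<in> I" for i
  proof (rule complex_eqI)
    have "orthogonal x (u i)" "orthogonal x (\<i> *s u i)"
      by (rule x(2), rule span_base, use that in \<open>simp add: S_def\<close>)+
    hence o: "Re (cip (u i) x) = 0" "Re (cip (\<i> *s u i) x) = 0"
      by (simp_all add: Re_cip orthogonal_def inner_commute)
    hence "cip (u i) x = 0"
      by (simp add: cip_scale_left complex_eq_iff)
    hence "cip (u i) z = 0"
      unfolding z_def by (simp only: cscale_eq_scaleR[symmetric] cip_scale_right mult_zero_right)
    thus "Re (cip (u i) z) = Re 0" "Im (cip (u i) z) = Im 0" by auto
  qed
  moreover have "norm z = 1"
    using x(1) by (simp add: z_def)
  ultimately show ?thesis by blast
qed

text \<open>
  The new eigenvector maximises the quadratic form of \<open>M\<close> on the unit sphere of the orthogonal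
  complement \<open>T\<close> of the old ones.
\<close>

lemma hermitian_next_eigenvector:
  fixes M :: "'n::finite cmat" and u :: "'n \<Rightarrow> complex ^ 'n"
  assumes herm: "adj M = M" and "I \<noteq> UNIV"
    and eig: "\<And>i. i \<in> I \<Longrightarrow> M *v u i = of_real (d i) *s u i"
  shows "\<exists>x l. norm x = 1 \<and> (\<forall>i\<in>I. cip (u i) x = 0) \<and> M *v x = of_real l *s x"
proof -
  define T where "T = {x. \<forall>i\<in>I. cip (u i) x = 0}"
  define q where "q x = Re (cip x (M *v x))" for x
  have T_scale: "r *\<^sub>R x \<in> T" if "x \<in> T" for x and r :: real
    using that unfolding T_def by (simp add: cscale_eq_scaleR[symmetric] cip_scale_right)
  have T_add: "x + y \<in> T" if "x \<in> T" "y \<in> T" for x y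
    using that unfolding T_def by (simp add: cip_add_right)
  have "closed T"
  proof -
    have "T = (\<Inter>i\<in>I. {x. cip (u i) x = 0})"
      by (auto simp: T_def)
    moreover have "closed {x. cip (u i) x = 0}" for i
      unfolding cip_def by (intro closed_Collect_eq continuous_intros)
    ultimately show ?thesis by auto
  qed
  hence "compact (sphere 0 1 \<inter> T)"
    by (simp add: compact_Int_closed)
  moreover have "sphere 0 1 \<inter> T \<noteq> {}"
    using exists_orthogonal_unit_vector[OF \<open>I \<noteq> UNIV\<close>, of u] by (auto simp: T_def)
  ultimately obtain x where x: "norm x = 1" "x \<in> T"
    and max: "\<And>y. norm y = 1 \<Longrightarrow> y \<in> T \<Longrightarrow> q y \<le> q x"
    using continuous_attains_sup[OF _ _ continuous_on_quadratic_form[of _ M], of "sphere 0 1 \<inter> T"]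
    unfolding q_def by (metis (no_types, lifting) IntE IntI mem_sphere_0)
  define l where "l = q x"
  define r where "r = M *v x - l *\<^sub>R x"
  \<comment> \<open>Homogeneity carries the bound from the unit sphere to all of \<open>T\<close>,
    since the variation below leaves the sphere.\<close>
  have q_le: "q y \<le> l * (norm y)\<^sup>2" if "y \<in> T" for y
  proof (cases "y = 0")
    case False
    have "q ((1 / norm y) *\<^sub>R y) \<le> l"
      unfolding l_def using False T_scale[OF that] by (intro max) auto
    moreover have "q ((1 / norm y) *\<^sub>R y) = q y / (norm y)\<^sup>2"
      by (simp add: q_def Re_cip cmat_vector_scaleR power2_eq_square)
    ultimately show ?thesis
      using False by (simp add: field_simps)
  qed (simp add: q_def Re_cip)
  have sym: "(M *v y) \<bullet> z = y \<bullet> (M *v z)" for y z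
    using cip_adj[of y M z] herm by (metis Re_cip)
  \<comment> \<open>\<open>T\<close> is invariant under \<open>M\<close>, because \<open>M\<close>
    is Hermitian and maps each \<open>u i\<close> to a multiple of itself.\<close>
  have "r \<in> T"
  proof -
    have "cip (u i) (M *v x) = 0" if "i \<in> I" for i
      using cip_adj[of "u i" M x] herm eig[OF that] x(2) that
      by (simp add: cip_scale_left T_def)
    hence "M *v x \<in> T" by (simp add: T_def)
    from T_add[OF this T_scale[OF x(2), of "- l"]] show ?thesis
      by (simp add: r_def)
  qed
  \<comment> \<open>Stationarity of \<open>q y - l * (norm y)\<^sup>2\<close> at its maximum
    \<open>x\<close> on \<open>T\<close>. The residual \<open>r\<close> is orthogonal to all of
    \<open>T\<close> and lies in \<open>T\<close>, so it vanishes.\<close>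
  have "y \<bullet> r = 0" if "y \<in> T" for y
  proof (rule quadratic_nonpos_imp_linear_zero)
    fix t :: real
    have "q (x + t *\<^sub>R y) - l * (norm (x + t *\<^sub>R y))\<^sup>2 \<le> 0"
      using q_le[OF T_add[OF x(2) T_scale[OF that, of t]]] by simp
    moreover have "q (x + t *\<^sub>R y) = q x + 2 * t * (y \<bullet> (M *v x)) + t\<^sup>2 * q y"
      using sym[of x y] inner_commute[of "M *v x" y]
      by (simp add: q_def Re_cip matrix_vector_right_distrib cmat_vector_scaleR
          inner_add_left inner_add_right algebra_simps power2_eq_square)
    moreover have "(norm (x + t *\<^sub>R y))\<^sup>2 = 1 + 2 * t * (y \<bullet> x) + t\<^sup>2 * (norm y)\<^sup>2"
      unfolding power2_norm_eq_inner using x(1)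
      by (simp add: norm_eq_1 inner_add_left inner_add_right
          inner_commute[of x y] algebra_simps power2_eq_square)
    ultimately show "2 * t * (y \<bullet> r) + t\<^sup>2 * (q y - l * (norm y)\<^sup>2) \<le> 0"
      by (simp add: r_def l_def inner_diff_right algebra_simps)
  qed
  from this[OF \<open>r \<in> T\<close>] have "M *v x = of_real l *s x"
    by (simp add: r_def cscale_eq_scaleR)
  thus ?thesis using x by (auto simp: T_def)
qed

theorem hermitian_diagonalisation:
  fixes M :: "'n::finite cmat"
  assumes "adj M = M"
  obtains U d where "unitary_mat U" "M = U ** cdiag d ** adj U"
proof -
  \<comment> \<open>The functions \<open>u\<close> and \<open>d\<close> are total but constrained
    only on \<open>I\<close>, so a new eigenvector enters by an update at one label.\<close>
  have "\<exists>u d. (\<forall>i\<in>I. M *v u i = of_real (d i) *s u i) \<and>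
      (\<forall>i\<in>I. \<forall>j\<in>I. cip (u i) (u j) = (if i = j then 1 else 0))" for I :: "'n set"
  proof (induction I rule: finite_induct[OF finite])
    case (2 k I)
    then obtain u d where ud: "\<And>i. i \<in> I \<Longrightarrow> M *v u i = of_real (d i) *s u i"
      "\<And>i j. i \<in> I \<Longrightarrow> j \<in> I \<Longrightarrow> cip (u i) (u j) = (if i = j then 1 else 0)"
      by blast
    have "I \<noteq> UNIV" using 2 by auto
    from hermitian_next_eigenvector[OF assms this, of u d, OF ud(1)] obtain x l where
      x: "norm x = 1" "\<And>i. i \<in> I \<Longrightarrow> cip (u i) x = 0" "M *v x = of_real l *s x"
      by blast
    have x': "cip x (u i) = 0" if "i \<in> I" for i
      using x(2)[OF that] cnj_cip[of "u i" x] by simp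
    have "cip x x = 1"
      by (simp add: cip_self x(1))
    show ?case
      by (rule exI[of _ "u(k := x)"], rule exI[of _ "d(k := l)"])
        (use \<open>k \<notin> I\<close> ud x x' \<open>cip x x = 1\<close> in auto)
  qed auto
  from this[of UNIV] obtain u :: "'n \<Rightarrow> complex ^ 'n" and d :: "'n \<Rightarrow> real" where ev: "\<And>i. M *v u i = of_real (d i) *s u i"
    and on: "\<And>i j. cip (u i) (u j) = (if i = j then 1 else 0)"
    by auto
  define U :: "'n cmat" where "U = (\<chi> i j. u j $ i)"
  have l: "adj U ** U = mat 1"
    by (simp add: vec_eq_iff matrix_matrix_mult_def U_def mat_def on[unfolded cip_def])
  hence r: "U ** adj U = mat 1"
    by (simp add: matrix_left_right_inverse)
  have "M ** U = U ** cdiag (vec_lambda d)"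
  proof -
    have "(M ** U) $ i $ j = (U ** cdiag (vec_lambda d)) $ i $ j" for i j
      using arg_cong[OF ev[of j], of "\<lambda>v. v $ i"]
      by (simp add: matrix_matrix_mult_def matrix_vector_mult_def U_def cdiag_def
          if_distrib[of "(*) _"] mult.commute cong: if_cong)
    thus ?thesis by (simp add: vec_eq_iff)
  qed
  hence "M ** (U ** adj U) = U ** cdiag (vec_lambda d) ** adj U"
    by (simp add: matrix_mul_assoc)
  hence "M = U ** cdiag (vec_lambda d) ** adj U"
    by (simp add: r)
  moreover have "unitary_mat U"
    by (simp add: unitary_mat_def dagger_eq_adj l r)
  ultimately show ?thesis using that by blast
qed

section \<open>Entropy and functional calculus\<close>

lemma unitary_matD:
  assumes "unitary_mat U"
  shows "U ** adj U = mat 1" "adj U ** U = mat 1"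
  using assms by (simp_all add: unitary_mat_def dagger_eq_adj)

lemma mult_cdiag_nth: "(A ** cdiag d) $ i $ j = A $ i $ j * of_real (d $ j)"
  for A :: "complex ^ 'n::finite ^ 'm::finite"
  by (simp add: matrix_matrix_mult_def cdiag_def if_distrib[of "(*) _"] cong: if_cong)

lemma cdiag_mult_nth: "(cdiag d ** A) $ i $ j = of_real (d $ i) * A $ i $ j"
  for A :: "complex ^ 'n::finite ^ 'm::finite"
  by (simp add: matrix_matrix_mult_def cdiag_def if_distrib[of "\<lambda>x. x * _"] cong: if_cong)

lemma cdiag_mult_cdiag: "cdiag d ** cdiag e = cdiag (\<chi> i. d $ i * e $ i)"
  by (simp add: vec_eq_iff mult_cdiag_nth) (simp add: cdiag_def)

lemma trace_cdiag: "trace (cdiag d) = of_real (\<Sum>i\<in>UNIV. d $ i)"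
  by (simp add: trace_def cdiag_def)

lemma trace_unitary_conj:
  assumes "unitary_mat U"
  shows "trace (U ** A ** adj U) = trace A"
  by (metis trace_mul_sym matrix_mul_assoc unitary_matD(2)[OF assms] matrix_mul_rid)

text \<open>Entrywise the hypothesis says that \<open>C\<close> connects only equal eigenvalues, a
  condition that survives applying \<open>f\<close> to both spectra. This is why the functional
  calculus does not depend on the diagonalisation.\<close>

lemma cdiag_intertwine:
  assumes "C ** cdiag d = cdiag e ** C"
  shows "C ** cdiag (\<chi> i. f (d $ i)) = cdiag (\<chi> i. f (e $ i)) ** C"
proof -
  have "C $ i $ j = 0 \<or> d $ j = e $ i" for i j
    using arg_cong[OF assms, of "\<lambda>A. A $ i $ j"] by (simp add: mult_cdiag_nth cdiag_mult_nth)
  thus ?thesis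
    by (auto simp: vec_eq_iff mult_cdiag_nth cdiag_mult_nth)
       (metis (no_types) mult.commute mult_zero_left)
qed

text \<open>Turns equality of two diagonalised matrices into a condition on the change of basis. It
  serves both the functional calculus and the equality case of Klein's inequality.\<close>

lemma diagonalisation_intertwine:
  assumes "unitary_mat U" "unitary_mat V"
  shows "U ** cdiag d ** adj U = V ** cdiag e ** adj V \<longleftrightarrow>
    (adj V ** U) ** cdiag d = cdiag e ** (adj V ** U)"
proof
  assume *: "U ** cdiag d ** adj U = V ** cdiag e ** adj V"
  have "(adj V ** U) ** cdiag d = adj V ** (U ** cdiag d ** adj U) ** U"
    by (metis matrix_mul_assoc unitary_matD(2)[OF assms(1)] matrix_mul_rid)
  also have "\<dots> = (adj V ** V) ** cdiag e ** (adj V ** U)"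
    unfolding * by (simp only: matrix_mul_assoc)
  also have "\<dots> = cdiag e ** (adj V ** U)"
    by (simp add: unitary_matD[OF assms(2)])
  finally show "(adj V ** U) ** cdiag d = cdiag e ** (adj V ** U)" .
next
  assume *: "(adj V ** U) ** cdiag d = cdiag e ** (adj V ** U)"
  have "U ** cdiag d ** adj U = V ** ((adj V ** U) ** cdiag d) ** adj U"
    by (simp add: matrix_mul_assoc unitary_matD[OF assms(2)])
  also have "\<dots> = V ** cdiag e ** adj V ** (U ** adj U)"
    unfolding * by (simp only: matrix_mul_assoc)
  also have "\<dots> = V ** cdiag e ** adj V"
    by (simp add: unitary_matD[OF assms(1)])
  finally show "U ** cdiag d ** adj U = V ** cdiag e ** adj V" .
qed

lemma herm_fun_diagonalisation:
  assumes "unitary_mat U"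
  shows "herm_fun f (U ** cdiag d ** adj U) = U ** cdiag (\<chi> i. f (d $ i)) ** adj U"
  unfolding herm_fun_def dagger_eq_adj
proof (rule the_equality)
  fix N
  assume "\<exists>V e. unitary_mat V \<and> U ** cdiag d ** adj U = V ** cdiag e ** adj V \<and>
    N = V ** cdiag (\<chi> i. f (e $ i)) ** adj V"
  then obtain V e where V: "unitary_mat V" "U ** cdiag d ** adj U = V ** cdiag e ** adj V"
    and N: "N = V ** cdiag (\<chi> i. f (e $ i)) ** adj V"
    by blast
  show "N = U ** cdiag (\<chi> i. f (d $ i)) ** adj U"
    unfolding N using V diagonalisation_intertwine[OF assms V(1)] cdiag_intertwine by metis
qed (use assms in blast)

lemma vn_entropy_diagonalisation:
  assumes "unitary_mat U"
  shows "vn_entropy (U ** cdiag d ** adj U) = - (\<Sum>i\<in>UNIV. d $ i * log 2 (d $ i))"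
proof -
  have "U ** cdiag d ** adj U ** (U ** cdiag (\<chi> i. log 2 (d $ i)) ** adj U)
      = U ** (cdiag d ** (adj U ** U) ** cdiag (\<chi> i. log 2 (d $ i))) ** adj U"
    by (simp only: matrix_mul_assoc)
  also have "\<dots> = U ** cdiag (\<chi> i. d $ i * log 2 (d $ i)) ** adj U"
    unfolding unitary_matD[OF assms]
    by (simp add: cdiag_mult_cdiag)
  finally show ?thesis
    by (simp add: vn_entropy_def herm_fun_diagonalisation[OF assms] trace_unitary_conj[OF assms]
        trace_cdiag)
qed

text \<open>
  In eigenbases of \<open>M M\<^sup>*\<close> and \<open>M\<^sup>* M\<close>, the matrix \<open>N\<close> of \<open>M\<close> intertwines the two spectra, and the
  row and column sums of \<open>\<bar>N $ i $ j\<bar>\<^sup>2\<close> are the eigenvalues.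
\<close>

lemma vn_entropy_mult_adj:
  fixes M :: "complex ^ 'n::finite ^ 'm::finite"
  shows "vn_entropy (M ** adj M) = vn_entropy (adj M ** M)"
proof -
  obtain U d where U: "unitary_mat U" "M ** adj M = U ** cdiag d ** adj U"
    by (rule hermitian_diagonalisation[of "M ** adj M"]) (simp_all add: adj_mult)
  obtain V e where V: "unitary_mat V" "adj M ** M = V ** cdiag e ** adj V"
    by (rule hermitian_diagonalisation[of "adj M ** M"]) (simp_all add: adj_mult)
  define N where "N = adj U ** M ** V"
  have NN: "N ** adj N = cdiag d"
  proof -
    have "N ** adj N = adj U ** M ** (V ** adj V) ** adj M ** U"
      by (simp add: N_def adj_mult matrix_mul_assoc)
    also have "\<dots> = adj U ** (M ** adj M) ** U"
      by (simp add: unitary_matD[OF V(1)] matrix_mul_assoc)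
    also have "\<dots> = (adj U ** U) ** cdiag d ** (adj U ** U)"
      unfolding U by (simp only: matrix_mul_assoc)
    finally show ?thesis by (simp add: unitary_matD[OF U(1)])
  qed
  have NN': "adj N ** N = cdiag e"
  proof -
    have "adj N ** N = adj V ** adj M ** (U ** adj U) ** M ** V"
      by (simp add: N_def adj_mult matrix_mul_assoc)
    also have "\<dots> = adj V ** (adj M ** M) ** V"
      by (simp add: unitary_matD[OF U(1)] matrix_mul_assoc)
    also have "\<dots> = (adj V ** V) ** cdiag e ** (adj V ** V)"
      unfolding V by (simp only: matrix_mul_assoc)
    finally show ?thesis by (simp add: unitary_matD[OF V(1)])
  qed
  \<comment> \<open>Both sides equal \<open>N ** adj N ** N\<close>.\<close>
  have "N ** cdiag e = cdiag d ** N"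
    by (simp add: NN[symmetric] NN'[symmetric] matrix_mul_assoc)
  hence eq: "N $ i $ j = 0 \<or> e $ j = d $ i" for i j
    by (drule_tac arg_cong[of _ _ "\<lambda>A. A $ i $ j"]) (simp add: mult_cdiag_nth cdiag_mult_nth)
  have d: "d $ i = (\<Sum>j\<in>UNIV. (cmod (N $ i $ j))\<^sup>2)" for i
  proof -
    have "complex_of_real (d $ i) = of_real (\<Sum>j\<in>UNIV. (cmod (N $ i $ j))\<^sup>2)"
      using arg_cong[OF NN, of "\<lambda>A. A $ i $ i"]
      by (simp add: matrix_matrix_mult_def cdiag_def complex_norm_square[symmetric])
    thus ?thesis by (simp only: of_real_eq_iff)
  qed
  have e: "e $ j = (\<Sum>i\<in>UNIV. (cmod (N $ i $ j))\<^sup>2)" for j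
  proof -
    have "complex_of_real (e $ j) = of_real (\<Sum>i\<in>UNIV. (cmod (N $ i $ j))\<^sup>2)"
      using arg_cong[OF NN', of "\<lambda>A. A $ j $ j"]
      by (simp add: matrix_matrix_mult_def cdiag_def complex_norm_square[symmetric] mult.commute[of "cnj _"])
    thus ?thesis by (simp only: of_real_eq_iff)
  qed
  \<comment> \<open>The two index types may differ in size. Surplus eigenvalues are zero, and all
    weights in their rows or columns vanish.\<close>
  have "(\<Sum>i\<in>UNIV. d $ i * log 2 (d $ i))
      = (\<Sum>i\<in>UNIV. \<Sum>j\<in>UNIV. (cmod (N $ i $ j))\<^sup>2 * log 2 (d $ i))"
    by (subst d) (simp add: sum_distrib_right)
  also have "\<dots> = (\<Sum>i\<in>UNIV. \<Sum>j\<in>UNIV. (cmod (N $ i $ j))\<^sup>2 * log 2 (e $ j))"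
    using eq by (intro sum.cong refl) (metis mult_zero_left norm_zero zero_power2)
  also have "\<dots> = (\<Sum>j\<in>UNIV. \<Sum>i\<in>UNIV. (cmod (N $ i $ j))\<^sup>2 * log 2 (e $ j))"
    by (rule sum.swap)
  also have "\<dots> = (\<Sum>j\<in>UNIV. e $ j * log 2 (e $ j))"
    by (simp add: e sum_distrib_right)
  finally show ?thesis
    by (simp add: U V vn_entropy_diagonalisation)
qed

text \<open>Transposition replaces the eigenbasis by its complex conjugate, the \<open>W\<close>
  below, and keeps the eigenvalues.\<close>

lemma vn_entropy_transpose:
  assumes "adj K = K"
  shows "vn_entropy (transpose K) = vn_entropy K"
proof -
  obtain V e where V: "unitary_mat V" "K = V ** cdiag e ** adj V"
    using hermitian_diagonalisation[OF assms] .
  define W where "W = transpose (adj V)"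
  have W: "adj W = transpose V"
    by (simp add: W_def vec_eq_iff transpose_def)
  have "transpose (cdiag e) = cdiag e"
    by (simp add: vec_eq_iff transpose_def cdiag_def)
  hence "transpose K = W ** cdiag e ** adj W"
    unfolding W by (simp add: V W_def matrix_transpose_mul matrix_mul_assoc)
  moreover have "unitary_mat W"
    using V(1) unfolding unitary_mat_def dagger_eq_adj W unfolding W_def
    by (metis matrix_transpose_mul transpose_mat)
  ultimately show ?thesis
    using V by (simp add: vn_entropy_diagonalisation)
qed

text \<open>If \<open>M\<close> holds the coefficients of a bipartite vector, the two matrices are
  its reduced operators on the two factors.\<close>

lemma vn_entropy_mult_adj_transpose:
  fixes M :: "complex ^ 'n::finite ^ 'm::finite"
  shows "vn_entropy (transpose M ** adj (transpose M)) = vn_entropy (M ** adj M)"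
proof -
  have "transpose M ** adj (transpose M) = transpose (adj M ** M)"
    by (simp add: matrix_transpose_mul) (simp add: vec_eq_iff matrix_matrix_mult_def transpose_def)
  thus ?thesis
    by (simp add: vn_entropy_transpose adj_mult vn_entropy_mult_adj)
qed

section \<open>Klein's inequality\<close>

lemma psd_iff: "psd M \<longleftrightarrow> adj M = M \<and> (\<forall>x. 0 \<le> Re (cip x (M *v x)))"
  by (simp add: psd_def dagger_eq_adj cip_def)

lemma unitary_conj_diag_entry:
  "(adj W ** M ** W) $ k $ k = cip (column k W) (M *v column k W)"
  unfolding matrix_mul_assoc[symmetric]
  by (simp add: cip_def column_def matrix_matrix_mult_def matrix_vector_mult_def)

lemma diagonalisation_entry:
  assumes "unitary_mat W"
  shows "(adj W ** (W ** cdiag l ** adj W) ** W) $ k $ k = of_real (l $ k)"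
proof -
  have "adj W ** (W ** cdiag l ** adj W) ** W = (adj W ** W) ** cdiag l ** (adj W ** W)"
    by (simp only: matrix_mul_assoc)
  thus ?thesis
    by (simp add: unitary_matD[OF assms]) (simp add: cdiag_def)
qed

lemma psd_diagonalisation:
  assumes "psd M"
  obtains U d where "unitary_mat U" "M = U ** cdiag d ** adj U" "\<And>i. d $ i \<ge> 0"
proof -
  obtain U d where U: "unitary_mat U" "M = U ** cdiag d ** adj U"
    using hermitian_diagonalisation[of M] assms by (auto simp: psd_iff)
  have "d $ i = Re (cip (column i U) (M *v column i U))" for i
    unfolding unitary_conj_diag_entry[symmetric] U(2) diagonalisation_entry[OF U(1)] by simp
  hence "d $ i \<ge> 0" for i
    using assms by (simp add: psd_iff)
  with U that show ?thesis by blast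
qed

lemma trace_diagonalisation:
  assumes "unitary_mat U"
  shows "Re (trace (U ** cdiag d ** adj U)) = (\<Sum>i\<in>UNIV. d $ i)"
  by (simp add: trace_unitary_conj[OF assms] trace_cdiag)

lemma vn_entropy_nonneg:
  assumes "density_op M"
  shows "vn_entropy M \<ge> 0"
proof -
  obtain U d where U: "unitary_mat U" "M = U ** cdiag d ** adj U" "\<And>i. d $ i \<ge> 0"
    using psd_diagonalisation[of M] assms by (auto simp: density_op_def)
  have s: "(\<Sum>i\<in>UNIV. d $ i) = 1"
    using trace_diagonalisation[OF U(1), of d] assms by (simp add: density_op_def U(2))
  have "d $ i * log 2 (d $ i) \<le> 0" for i
  proof -
    have "d $ i \<le> 1"
      using U(3) s member_le_sum[of i UNIV "\<lambda>i. d $ i"] by simp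
    hence "log 2 (d $ i) \<le> 0"
      using U(3)[of i] by (cases "d $ i = 0") (auto simp: log_def divide_le_0_iff less_le)
    thus ?thesis
      using U(3)[of i] by (simp add: mult_nonneg_nonpos)
  qed
  thus ?thesis
    unfolding U(2) vn_entropy_diagonalisation[OF U(1)] by (simp add: sum_nonpos)
qed

text \<open>This is \<open>ln x \<le> x - 1\<close> at \<open>x = l / m\<close>, multiplied by
  \<open>m\<close>, with equality only at \<open>x = 1\<close>. For \<open>m = 0\<close> the
  expression is \<open>l\<close>, which is positive.\<close>

lemma log_tangent_gap:
  fixes m l :: real
  assumes "m \<ge> 0" "l > 0"
  shows "l - m - m * (ln l - ln m) \<ge> 0"
    and "l - m - m * (ln l - ln m) = 0 \<Longrightarrow> m = l"
proof -
  have *: "ln l - ln m = ln (l / m)" "m * (l / m) = l" if "m > 0"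
    using that assms by (simp_all add: ln_div)
  show "l - m - m * (ln l - ln m) \<ge> 0"
  proof (cases "m = 0")
    case False
    hence "m > 0" using assms by simp
    hence "m * ln (l / m) \<le> m * (l / m - 1)"
      using assms by (intro mult_left_mono ln_le_minus_one) auto
    thus ?thesis
      using *[OF \<open>m > 0\<close>] by (simp add: algebra_simps)
  qed (use assms in simp)
  show "m = l" if eq: "l - m - m * (ln l - ln m) = 0"
  proof (cases "m = 0")
    case False
    hence "m > 0" using assms by simp
    hence "m * ln (l / m) = m * (l / m - 1)"
      using eq *[OF \<open>m > 0\<close>] by (simp add: algebra_simps)
    hence "ln (l / m) = l / m - 1"
      using \<open>m > 0\<close> by simp
    hence "l / m = 1"
      using \<open>m > 0\<close> assms by (intro ln_eq_minus_one) auto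
    thus ?thesis using \<open>m > 0\<close> by simp
  qed (use eq assms in simp)
qed

text \<open>
  \<open>D\<close> is \<open>Tr \<tau> ln \<tau> - Tr \<tau> ln \<sigma> - Tr \<tau> + Tr \<sigma>\<close>, with the second trace evaluated in
  the eigenbasis \<open>W\<close> of \<open>\<sigma>\<close>.
\<close>

lemma klein_inequality:
  fixes V W :: "'n::finite cmat"
  assumes V: "unitary_mat V" and W: "unitary_mat W"
    and m: "\<And>j. m $ j \<ge> 0" and l: "\<And>k. l $ k \<ge> 0"
    and \<tau>: "\<tau> = V ** cdiag m ** adj V" and \<sigma>: "\<sigma> = W ** cdiag l ** adj W"
    and t: "\<And>k. t k = Re ((adj W ** \<tau> ** W) $ k $ k)"
    and ker: "\<And>k. l $ k = 0 \<Longrightarrow> t k = 0"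
    and D: "D = (\<Sum>j\<in>UNIV. m $ j * ln (m $ j)) - (\<Sum>k\<in>UNIV. t k * ln (l $ k))
      - (\<Sum>j\<in>UNIV. m $ j) + (\<Sum>k\<in>UNIV. l $ k)"
  shows "D \<ge> 0" and "D = 0 \<Longrightarrow> \<tau> = \<sigma>"
proof -
  \<comment> \<open>\<open>C\<close> is the change of basis between the two eigenbases. The squared
    moduli of its entries form a doubly stochastic matrix.\<close>
  define C where "C = adj W ** V"
  define c where "c k j = (cmod (C $ k $ j))\<^sup>2" for k j
  have c: "complex_of_real (c k j) = C $ k $ j * cnj (C $ k $ j)" for k j
    unfolding c_def by (rule complex_norm_square)
  have C1: "C ** adj C = mat 1" "adj C ** C = mat 1"
    unfolding C_def adj_mult adj_adj
    by (metis V W matrix_mul_assoc matrix_mul_rid unitary_matD)+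
  have row: "(\<Sum>j\<in>UNIV. c k j) = 1" for k
  proof -
    have "complex_of_real (\<Sum>j\<in>UNIV. c k j) = of_real 1"
      using arg_cong[OF C1(1), of "\<lambda>A. A $ k $ k"] by (simp add: c matrix_matrix_mult_def mat_def)
    thus ?thesis by (simp only: of_real_eq_iff)
  qed
  have col: "(\<Sum>k\<in>UNIV. c k j) = 1" for j
  proof -
    have "complex_of_real (\<Sum>k\<in>UNIV. c k j) = of_real 1"
      using arg_cong[OF C1(2), of "\<lambda>A. A $ j $ j"]
      by (simp add: c matrix_matrix_mult_def mat_def mult.commute)
    thus ?thesis by (simp only: of_real_eq_iff)
  qed
  have tc: "t k = (\<Sum>j\<in>UNIV. c k j * m $ j)" for k
  proof -
    have "adj W ** \<tau> ** W = C ** cdiag m ** adj C"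
      by (simp add: \<tau> C_def adj_mult matrix_mul_assoc)
    hence "(adj W ** \<tau> ** W) $ k $ k = of_real (\<Sum>j\<in>UNIV. c k j * m $ j)"
      by (simp add: matrix_matrix_mult_def[of "C ** cdiag m"] mult_cdiag_nth c ac_simps)
    thus ?thesis by (simp add: t)
  qed
  \<comment> \<open>As rows and columns of \<open>c\<close> sum to one, \<open>D\<close> is the
    \<open>c\<close>-weighted sum of these tangent gaps.\<close>
  define g where "g k j = l $ k - m $ j - m $ j * (ln (l $ k) - ln (m $ j))" for k j
  have zero: "c k j * m $ j = 0" if "l $ k = 0" for k j
    using ker[OF that] m unfolding tc
    by (subst (asm) sum_nonneg_eq_0_iff) (auto simp: c_def)
  have cg: "c k j * g k j \<ge> 0 \<and> (c k j * g k j = 0 \<longrightarrow> c k j = 0 \<or> m $ j = l $ k)" for k j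
  proof (cases "l $ k = 0")
    case True
    thus ?thesis using zero[OF True, of j] by (auto simp: g_def)
  next
    case False
    hence "l $ k > 0" using l[of k] by simp
    thus ?thesis
      using log_tangent_gap[OF m[of j], of "l $ k"] by (auto simp: g_def c_def)
  qed
  have "(\<Sum>k\<in>UNIV. \<Sum>j\<in>UNIV. c k j * g k j) =
      (\<Sum>k\<in>UNIV. \<Sum>j\<in>UNIV. c k j * l $ k) - (\<Sum>k\<in>UNIV. \<Sum>j\<in>UNIV. c k j * m $ j)
      - (\<Sum>k\<in>UNIV. \<Sum>j\<in>UNIV. c k j * m $ j * ln (l $ k))
      + (\<Sum>k\<in>UNIV. \<Sum>j\<in>UNIV. c k j * (m $ j * ln (m $ j)))"
    by (simp add: g_def algebra_simps sum.distrib sum_subtractf)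
  also have "(\<Sum>k\<in>UNIV. \<Sum>j\<in>UNIV. c k j * l $ k) = (\<Sum>k\<in>UNIV. l $ k)"
    by (simp add: sum_distrib_right[symmetric] row)
  also have "(\<Sum>k\<in>UNIV. \<Sum>j\<in>UNIV. c k j * m $ j) = (\<Sum>j\<in>UNIV. m $ j)"
    by (subst sum.swap) (simp add: sum_distrib_right[symmetric] col)
  also have "(\<Sum>k\<in>UNIV. \<Sum>j\<in>UNIV. c k j * (m $ j * ln (m $ j))) = (\<Sum>j\<in>UNIV. m $ j * ln (m $ j))"
    by (subst sum.swap) (simp add: sum_distrib_right[symmetric] col)
  also have "(\<Sum>k\<in>UNIV. \<Sum>j\<in>UNIV. c k j * m $ j * ln (l $ k)) = (\<Sum>k\<in>UNIV. t k * ln (l $ k))"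
    by (simp add: tc sum_distrib_right)
  finally have D_sum: "D = (\<Sum>k\<in>UNIV. \<Sum>j\<in>UNIV. c k j * g k j)"
    by (simp add: D)
  show "D \<ge> 0"
    unfolding D_sum using cg by (intro sum_nonneg) auto
  show "\<tau> = \<sigma>" if "D = 0"
  proof -
    have "c k j * g k j = 0" for k j
    proof -
      have "(\<Sum>j\<in>UNIV. c k j * g k j) = 0"
        using that cg unfolding D_sum by (subst (asm) sum_nonneg_eq_0_iff) (auto intro!: sum_nonneg)
      thus ?thesis
        using cg by (subst (asm) sum_nonneg_eq_0_iff) auto
    qed
    hence "C $ k $ j = 0 \<or> m $ j = l $ k" for k j
      using cg[of k j] by (auto simp: c_def)
    hence "C ** cdiag m = cdiag l ** C"
      by (auto simp: vec_eq_iff mult_cdiag_nth cdiag_mult_nth)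
    thus ?thesis
      unfolding \<tau> \<sigma> C_def diagonalisation_intertwine[OF V W] .
  qed
qed

section \<open>Strict concavity of the entropy\<close>

lemma cip_sum_scaleR:
  fixes \<tau> :: "'i \<Rightarrow> 'n::finite cmat"
  assumes "finite I"
  shows "cip x ((\<Sum>i\<in>I. p i *\<^sub>R \<tau> i) *v y) = (\<Sum>i\<in>I. of_real (p i) * cip x (\<tau> i *v y))"
  using assms
proof (induction I rule: finite_induct)
  case empty
  show ?case by (simp add: cip_def)
next
  case (insert i I)
  have "(p i *\<^sub>R \<tau> i) *v y = of_real (p i) *s (\<tau> i *v y)"
    by (simp add: vec_eq_iff matrix_vector_mult_def scaleR_conv_of_real[of _ "_ :: complex"]
        sum_distrib_left mult.assoc)
  with insert show ?case
    by (simp add: matrix_vector_mult_add_rdistrib cip_add_right cip_scale_right)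
qed

lemma hermitian_sum_scaleR:
  assumes "\<And>i. i \<in> I \<Longrightarrow> adj (\<tau> i) = \<tau> i"
  shows "adj (\<Sum>i\<in>I. p i *\<^sub>R \<tau> i) = (\<Sum>i\<in>I. p i *\<^sub>R \<tau> i)"
proof -
  have "cnj (\<tau> i $ b $ a) = \<tau> i $ a $ b" if "i \<in> I" for i a b
    using arg_cong[OF assms[OF that], of "\<lambda>A. A $ a $ b"] by simp
  thus ?thesis
    by (simp add: vec_eq_iff)
qed

lemma psd_sum_scaleR:
  assumes "finite I" "\<And>i. i \<in> I \<Longrightarrow> p i \<ge> 0" "\<And>i. i \<in> I \<Longrightarrow> psd (\<tau> i)"
  shows "psd (\<Sum>i\<in>I. p i *\<^sub>R \<tau> i)"
  using assms hermitian_sum_scaleR[of I \<tau> p] unfolding psd_iff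
  by (auto simp: cip_sum_scaleR intro!: sum_nonneg)

text \<open>Both traces are one, so the correction terms of Klein's inequality cancel. What remains
  compares the entropy with the cross entropy; \<open>ln 2\<close> converts the base of the
  logarithm.\<close>

lemma klein_inequality_density:
  assumes \<tau>: "density_op \<tau>" and W: "unitary_mat W" and l: "\<And>k. l $ k \<ge> 0" "(\<Sum>k\<in>UNIV. l $ k) = 1"
    and ker: "\<And>k. l $ k = 0 \<Longrightarrow> Re ((adj W ** \<tau> ** W) $ k $ k) = 0"
  shows "ln 2 * vn_entropy \<tau> \<le> - (\<Sum>k\<in>UNIV. Re ((adj W ** \<tau> ** W) $ k $ k) * ln (l $ k))"
    and "ln 2 * vn_entropy \<tau> = - (\<Sum>k\<in>UNIV. Re ((adj W ** \<tau> ** W) $ k $ k) * ln (l $ k)) \<Longrightarrow>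
      \<tau> = W ** cdiag l ** adj W"
proof -
  obtain V m where V: "unitary_mat V" "\<tau> = V ** cdiag m ** adj V" "\<And>i. m $ i \<ge> 0"
    using psd_diagonalisation[of \<tau>] \<tau> by (auto simp: density_op_def)
  have m: "(\<Sum>j\<in>UNIV. m $ j) = 1"
    using trace_diagonalisation[OF V(1), of m] \<tau> by (simp add: density_op_def V(2))
  have S: "(\<Sum>j\<in>UNIV. m $ j * ln (m $ j)) = - (ln 2 * vn_entropy \<tau>)"
    unfolding V(2) vn_entropy_diagonalisation[OF V(1)]
    by (simp add: log_def sum_divide_distrib[symmetric])
  note K = klein_inequality[OF V(1) W V(3) l(1) V(2) refl refl ker refl]
  show "ln 2 * vn_entropy \<tau> \<le> - (\<Sum>k\<in>UNIV. Re ((adj W ** \<tau> ** W) $ k $ k) * ln (l $ k))"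
    using K(1) by (simp add: S m l)
  show "\<tau> = W ** cdiag l ** adj W"
    if "ln 2 * vn_entropy \<tau> = - (\<Sum>k\<in>UNIV. Re ((adj W ** \<tau> ** W) $ k $ k) * ln (l $ k))"
    using that by (intro K(2)) (simp_all add: S m l)
qed

text \<open>The cross entropy against \<open>\<sigma>\<close> is linear in the state, so the
  \<open>p\<close>-average of the Klein gaps is \<open>ln 2\<close> times the entropy gain. By
  \<open>le\<close> this is at most zero, hence every gap vanishes and the equality case
  applies.\<close>

theorem vn_entropy_strictly_concave:
  fixes \<tau> :: "'i \<Rightarrow> 'n::finite cmat"
  assumes fin: "finite I" and p: "\<And>i. i \<in> I \<Longrightarrow> p i > 0" "(\<Sum>i\<in>I. p i) = 1"
    and \<tau>: "\<And>i. i \<in> I \<Longrightarrow> density_op (\<tau> i)"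
    and \<sigma>: "\<sigma> = (\<Sum>i\<in>I. p i *\<^sub>R \<tau> i)"
    and le: "vn_entropy \<sigma> \<le> (\<Sum>i\<in>I. p i * vn_entropy (\<tau> i))"
    and "i \<in> I"
  shows "\<tau> i = \<sigma>"
proof -
  have "psd \<sigma>"
    unfolding \<sigma> using fin p(1) \<tau> by (intro psd_sum_scaleR) (auto simp: density_op_def less_imp_le)
  then obtain W l where W: "unitary_mat W" "\<sigma> = W ** cdiag l ** adj W" and l: "\<And>k. l $ k \<ge> 0"
    using psd_diagonalisation by blast
  define t where "t i k = Re ((adj W ** \<tau> i ** W) $ k $ k)" for i k
  have t_nonneg: "t i k \<ge> 0" if "i \<in> I" for i k
    using \<tau>[OF that] by (simp add: t_def unitary_conj_diag_entry density_op_def psd_iff)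
  have lt: "l $ k = (\<Sum>i\<in>I. p i * t i k)" for k
  proof -
    have "l $ k = Re (cip (column k W) (\<sigma> *v column k W))"
      unfolding unitary_conj_diag_entry[symmetric] W(2) diagonalisation_entry[OF W(1)] by simp
    thus ?thesis
      by (simp add: \<sigma> cip_sum_scaleR[OF fin] t_def unitary_conj_diag_entry)
  qed
  have t_sum: "(\<Sum>k\<in>UNIV. t i k) = 1" if "i \<in> I" for i
  proof -
    have "trace (adj W ** \<tau> i ** W) = trace (\<tau> i)"
      by (metis trace_mul_sym matrix_mul_assoc unitary_matD(1)[OF W(1)] matrix_mul_rid)
    hence "Re (trace (adj W ** \<tau> i ** W)) = 1"
      using \<tau>[OF that] by (simp add: density_op_def)
    thus ?thesis by (simp add: trace_def t_def)
  qed
  have l_sum: "(\<Sum>k\<in>UNIV. l $ k) = 1"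
    unfolding lt using p(2) t_sum by (subst sum.swap) (simp add: sum_distrib_left[symmetric])
  \<comment> \<open>A zero eigenvalue of the average is a sum of nonnegative terms with positive
    weights, so each component vanishes in that direction.\<close>
  have ker: "t i k = 0" if "l $ k = 0" "i \<in> I" for i k
  proof -
    have "p i * t i k = 0"
      using that p(1) t_nonneg unfolding lt
      by (subst (asm) sum_nonneg_eq_0_iff[OF fin]) (auto simp: less_imp_le)
    thus ?thesis using p(1)[OF that(2)] by simp
  qed
  define g where "g i = - (\<Sum>k\<in>UNIV. t i k * ln (l $ k)) - ln 2 * vn_entropy (\<tau> i)" for i
  note K = klein_inequality_density[OF \<tau> W(1) l l_sum ker[unfolded t_def]]
  have g: "g i \<ge> 0" if "i \<in> I" for i
    using K(1)[OF that] that by (simp add: g_def t_def)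
  have "(\<Sum>i\<in>I. p i * (\<Sum>k\<in>UNIV. t i k * ln (l $ k))) = (\<Sum>k\<in>UNIV. l $ k * ln (l $ k))"
    unfolding sum_distrib_left
    by (subst sum.swap) (simp add: lt sum_distrib_right mult.assoc)
  also have "\<dots> = - (ln 2 * vn_entropy \<sigma>)"
    unfolding W(2) vn_entropy_diagonalisation[OF W(1)]
    by (simp add: log_def sum_divide_distrib[symmetric])
  finally have "(\<Sum>i\<in>I. p i * g i) = ln 2 * vn_entropy \<sigma> - ln 2 * (\<Sum>i\<in>I. p i * vn_entropy (\<tau> i))"
    by (simp add: g_def right_diff_distrib sum_subtractf sum_negf sum_distrib_left ac_simps)
  also have "\<dots> \<le> 0"
    using le by (simp add: mult_left_mono)
  finally have "(\<Sum>i\<in>I. p i * g i) = 0"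
    using g p(1) by (intro antisym sum_nonneg) (auto simp: less_imp_le)
  hence "p i * g i = 0"
    using g p(1) \<open>i \<in> I\<close> by (subst (asm) sum_nonneg_eq_0_iff[OF fin]) (auto simp: less_imp_le)
  hence "g i = 0"
    using p(1)[OF \<open>i \<in> I\<close>] by simp
  thus ?thesis
    using K(2)[OF \<open>i \<in> I\<close>] \<open>i \<in> I\<close> by (simp add: g_def t_def W(2))
qed

section \<open>Measurements on the second system\<close>

lemma psd_mult_adj:
  fixes A :: "complex ^ 'n::finite ^ 'm::finite"
  assumes "psd P"
  shows "psd (A ** P ** adj A)"
  unfolding psd_iff
proof (intro conjI allI)
  show "adj (A ** P ** adj A) = A ** P ** adj A"
    using assms by (simp add: psd_iff adj_mult matrix_mul_assoc)
  show "0 \<le> Re (cip x ((A ** P ** adj A) *v x))" for x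
  proof -
    have "cip x ((A ** P ** adj A) *v x) = cip (adj A *v x) (P *v (adj A *v x))"
      by (simp add: matrix_vector_mul_assoc[symmetric] cip_adj)
    thus ?thesis using assms by (simp add: psd_iff)
  qed
qed

lemma psd_mat_1: "psd (mat 1)"
proof -
  have "adj (mat 1) = mat 1"
    by (simp add: vec_eq_iff mat_def)
  thus ?thesis by (simp add: psd_iff cip_self)
qed

text \<open>The quadratic form of the transpose at \<open>x\<close> is that of \<open>M\<close> at
  the complex conjugate of \<open>x\<close>.\<close>

lemma psd_transpose:
  assumes "psd M"
  shows "psd (transpose M)"
  unfolding psd_iff
proof (intro conjI allI)
  have h: "cnj (M $ j $ i) = M $ i $ j" for i j
    using assms unfolding psd_iff by (metis adj_nth)
  show "adj (transpose M) = transpose M"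
    by (simp add: vec_eq_iff transpose_def h)
  show "0 \<le> Re (cip x (transpose M *v x))" for x
  proof -
    have "cip x (transpose M *v x) = cip (\<chi> i. cnj (x $ i)) (M *v (\<chi> i. cnj (x $ i)))"
      by (simp add: cip_def matrix_vector_mult_def transpose_def sum_distrib_left, subst sum.swap)
        (simp add: ac_simps)
    thus ?thesis using assms by (simp add: psd_iff)
  qed
qed

lemma psd_sum:
  assumes "finite I" "\<And>i. i \<in> I \<Longrightarrow> psd (\<tau> i)"
  shows "psd (\<Sum>i\<in>I. \<tau> i)"
  using psd_sum_scaleR[of I "\<lambda>_. 1" \<tau>] assms by simp

lemma psd_scaleR:
  assumes "r \<ge> 0" "psd M"
  shows "psd (r *\<^sub>R M)"
  using psd_sum_scaleR[of "{()}" "\<lambda>_. r" "\<lambda>_. M"] assms by simp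

lemma trace_scaleR: "trace (r *\<^sub>R M) = of_real r * trace M" for M :: "'n::finite cmat"
  by (simp add: trace_def sum_distrib_left scaleR_conv_of_real[of _ "_ :: complex"])

lemma trace_psd:
  assumes "psd M"
  shows "trace M = of_real (Re (trace M))" "Re (trace M) \<ge> 0"
proof -
  obtain U d where U: "unitary_mat U" "M = U ** cdiag d ** adj U" "\<And>i. d $ i \<ge> 0"
    using psd_diagonalisation[OF assms] by blast
  show "trace M = of_real (Re (trace M))"
    by (simp add: U trace_unitary_conj[OF U(1)] trace_cdiag)
  show "Re (trace M) \<ge> 0"
    unfolding U(2) trace_diagonalisation[OF U(1)] using U(3) by (simp add: sum_nonneg)
qed

lemma density_op_normalise:
  assumes "psd M" "Re (trace M) \<noteq> 0"
  shows "density_op ((1 / Re (trace M)) *\<^sub>R M)"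
proof -
  define r where "r = Re (trace M)"
  have "trace M = of_real r"
    unfolding r_def using trace_psd(1)[OF assms(1)] .
  thus ?thesis
    using assms trace_psd(2)[OF assms(1)]
    by (simp add: density_op_def psd_scaleR trace_scaleR r_def[symmetric])
qed

lemma trace_mult_adj:
  fixes M :: "complex ^ 'n::finite ^ 'm::finite"
  shows "trace (M ** adj M) = of_real (\<Sum>i\<in>UNIV. \<Sum>j\<in>UNIV. (cmod (M $ i $ j))\<^sup>2)"
  by (simp add: trace_def matrix_matrix_mult_def complex_norm_square[symmetric])

text \<open>The trace is the squared Hilbert-Schmidt norm. This settles the outcomes of probability
  zero and, later, the separation of points.\<close>

lemma trace_mult_adj_eq_0:
  fixes M :: "complex ^ 'n::finite ^ 'm::finite"
  assumes "Re (trace (M ** adj M)) = 0"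
  shows "M = 0"
proof -
  have "(\<Sum>i\<in>UNIV. \<Sum>j\<in>UNIV. (cmod (M $ i $ j))\<^sup>2) = 0"
    using assms unfolding trace_mult_adj by simp
  hence "(\<Sum>j\<in>UNIV. (cmod (M $ i $ j))\<^sup>2) = 0" for i
    by (subst (asm) sum_nonneg_eq_0_iff) (auto intro: sum_nonneg)
  hence "(cmod (M $ i $ j))\<^sup>2 = 0" for i j
    by (subst (asm) sum_nonneg_eq_0_iff) auto
  thus ?thesis by (simp add: vec_eq_iff)
qed

lemma ketbra_nth: "ketbra v $ i $ j = v $ i * cnj (v $ j)"
  by (simp add: ketbra_def)

lemma psd_ketbra: "psd (ketbra v)"
proof -
  have "adj (ketbra v) = ketbra v"
    by (simp add: vec_eq_iff ketbra_def mult.commute)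
  moreover have "cip x (ketbra v *v x) = cip x v * cnj (cip x v)" for x
    by (simp add: cip_def ketbra_def matrix_vector_mult_def sum_distrib_left sum_distrib_right
        ac_simps) (rule sum.swap)
  ultimately show ?thesis
    by (simp add: psd_iff complex_norm_square[symmetric])
qed

lemma sum_ketbra_columns:
  assumes "unitary_mat U"
  shows "(\<Sum>j\<in>UNIV. ketbra (column j U)) = mat 1"
proof -
  have "(\<Sum>j\<in>UNIV. ketbra (column j U)) = U ** adj U"
    by (simp add: vec_eq_iff ketbra_def column_def matrix_matrix_mult_def)
  thus ?thesis by (simp add: unitary_matD[OF assms])
qed

lemma trace_ptrace2: "trace (ptrace2 M) = trace M"
  by (simp add: trace_def ptrace2_def sum.cartesian_product UNIV_Times_UNIV)

lemma ptrace2_local_mult_nth: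
  "ptrace2 ((mat 1 \<otimes>\<^sub>m F) ** \<rho>) $ a $ a' = (\<Sum>b\<in>UNIV. \<Sum>b'\<in>UNIV. F $ b $ b' * \<rho> $ (a, b') $ (a', b))"
proof -
  have "((mat 1 \<otimes>\<^sub>m F) ** \<rho>) $ (a, b) $ (a', b) = (\<Sum>b'\<in>UNIV. F $ b $ b' * \<rho> $ (a, b') $ (a', b))" for b
  proof -
    have "((mat 1 \<otimes>\<^sub>m F) ** \<rho>) $ (a, b) $ (a', b) = (\<Sum>c\<in>UNIV. \<Sum>b'\<in>UNIV.
        (mat 1 $ a $ c * F $ b $ b') * \<rho> $ (c, b') $ (a', b))"
      by (simp add: matrix_matrix_mult_def tensor_def sum.cartesian_product UNIV_Times_UNIV
          split_def)
    also have "\<dots> = (\<Sum>c\<in>UNIV. if a = c then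
        (\<Sum>b'\<in>UNIV. F $ b $ b' * \<rho> $ (c, b') $ (a', b)) else 0)"
      by (intro sum.cong refl) (simp add: mat_def)
    finally show ?thesis by simp
  qed
  thus ?thesis by (simp add: ptrace2_def)
qed

lemma outcome_prob_eq_trace: "outcome_prob \<rho> F = Re (trace (ptrace2 ((mat 1 \<otimes>\<^sub>m F) ** \<rho>)))"
  by (simp add: outcome_prob_def trace_ptrace2)

lemma ptrace2_ketbra_nth: "ptrace2 (ketbra \<Psi>) $ i $ j = (\<Sum>e\<in>UNIV. \<Psi> $ (i, e) * cnj (\<Psi> $ (j, e)))"
  by (simp add: ptrace2_def ketbra_def)

context
  fixes \<Psi> :: "complex ^ (('a::finite \<times> 'b::finite) \<times> 'e::finite)"
begin

text \<open>Each basis label \<open>e\<close> of the environment gives a slice \<open>A e\<close> of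
  \<open>\<Psi>\<close>, and the unnormalised state after the outcome is a sum of congruences of
  \<open>transpose F\<close> by these slices.\<close>

lemma psd_ptrace2_local_mult:
  assumes "psd F"
  shows "psd (ptrace2 ((mat 1 \<otimes>\<^sub>m F) ** ptrace2 (ketbra \<Psi>)))"
proof -
  define A where "A e = (\<chi> a b. \<Psi> $ ((a, b), e))" for e
  have "ptrace2 ((mat 1 \<otimes>\<^sub>m F) ** ptrace2 (ketbra \<Psi>)) = (\<Sum>e\<in>UNIV. A e ** transpose F ** adj (A e))"
  proof -
    have "ptrace2 ((mat 1 \<otimes>\<^sub>m F) ** ptrace2 (ketbra \<Psi>)) $ a $ a' =
        (\<Sum>e\<in>UNIV. A e ** transpose F ** adj (A e)) $ a $ a'" for a a'
    proof -
      have "ptrace2 ((mat 1 \<otimes>\<^sub>m F) ** ptrace2 (ketbra \<Psi>)) $ a $ a' =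
          (\<Sum>b\<in>UNIV. \<Sum>b'\<in>UNIV. \<Sum>e\<in>UNIV. F $ b $ b' * (\<Psi> $ ((a, b'), e) * cnj (\<Psi> $ ((a', b), e))))"
        by (simp add: ptrace2_local_mult_nth ptrace2_ketbra_nth sum_distrib_left)
      also have "\<dots> = (\<Sum>b\<in>UNIV. \<Sum>e\<in>UNIV. \<Sum>b'\<in>UNIV.
          F $ b $ b' * (\<Psi> $ ((a, b'), e) * cnj (\<Psi> $ ((a', b), e))))"
        by (intro sum.cong refl sum.swap)
      also have "\<dots> = (\<Sum>e\<in>UNIV. \<Sum>b\<in>UNIV. \<Sum>b'\<in>UNIV.
          F $ b $ b' * (\<Psi> $ ((a, b'), e) * cnj (\<Psi> $ ((a', b), e))))"
        by (rule sum.swap)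
      also have "\<dots> = (\<Sum>e\<in>UNIV. A e ** transpose F ** adj (A e)) $ a $ a'"
        by (simp add: matrix_matrix_mult_def A_def transpose_def sum_distrib_left
            sum_distrib_right ac_simps)
      finally show ?thesis .
    qed
    thus ?thesis by (simp add: vec_eq_iff)
  qed
  thus ?thesis
    using assms by (simp add: psd_sum psd_mult_adj psd_transpose)
qed

lemma density_op_post_state:
  assumes "psd F" "outcome_prob (ptrace2 (ketbra \<Psi>)) F \<noteq> 0"
  shows "density_op (post_state (ptrace2 (ketbra \<Psi>)) F)"
  unfolding post_state_def outcome_prob_eq_trace
  using assms density_op_normalise[OF psd_ptrace2_local_mult] by (simp add: outcome_prob_eq_trace)

text \<open>Probabilities and entropies are nonnegative. This supplies the bound that makes the
  supremum in \<open>classical_corr\<close> an upper bound of its set.\<close>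

lemma measured_info_le:
  assumes "povm n E"
  shows "measured_info (ptrace2 (ketbra \<Psi>)) n E \<le> vn_entropy (ptrace2 (ptrace2 (ketbra \<Psi>)))"
proof -
  let ?\<rho> = "ptrace2 (ketbra \<Psi>)"
  have "outcome_prob ?\<rho> (E i) * vn_entropy (post_state ?\<rho> (E i)) \<ge> 0"
    if "i < n" "outcome_prob ?\<rho> (E i) \<noteq> 0" for i
    using assms that density_op_post_state[of "E i"] trace_psd(2)[OF psd_ptrace2_local_mult[of "E i"]]
    by (simp add: povm_def vn_entropy_nonneg outcome_prob_eq_trace)
  thus ?thesis
    unfolding measured_info_def by (auto intro!: sum_nonneg)
qed

lemma measured_info_le_classical_corr:
  assumes "povm n E"
  shows "measured_info (ptrace2 (ketbra \<Psi>)) n E \<le> classical_corr (ptrace2 (ketbra \<Psi>))"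
  unfolding classical_corr_def
  using assms measured_info_le by (intro cSup_upper bdd_aboveI) blast+

end

section \<open>Rank-one measurements on a purification\<close>

text \<open>Coefficient matrix, with respect to A and E, of the unnormalised vector left when B is
  projected onto \<open>v\<close>.\<close>

definition branch :: "complex ^ (('a::finite \<times> 'b::finite) \<times> 'e::finite) \<Rightarrow> complex ^ 'b \<Rightarrow>
    complex ^ 'e ^ 'a" where
  "branch \<Psi> v = (\<chi> a e. \<Sum>b\<in>UNIV. cnj (v $ b) * \<Psi> $ ((a, b), e))"

text \<open>The unnormalised state of E after the outcome \<open>v\<close>; its trace is the
  probability of that outcome.\<close>

definition env :: "complex ^ (('a::finite \<times> 'b::finite) \<times> 'e::finite) \<Rightarrow> complex ^ 'b \<Rightarrow>
    'e cmat" where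
  "env \<Psi> v = transpose (branch \<Psi> v) ** adj (transpose (branch \<Psi> v))"

lemma ptrace2_local_ketbra:
  "ptrace2 ((mat 1 \<otimes>\<^sub>m ketbra v) ** ptrace2 (ketbra \<Psi>)) = branch \<Psi> v ** adj (branch \<Psi> v)"
proof -
  have "ptrace2 ((mat 1 \<otimes>\<^sub>m ketbra v) ** ptrace2 (ketbra \<Psi>)) $ a $ a' =
      (branch \<Psi> v ** adj (branch \<Psi> v)) $ a $ a'" for a a'
  proof -
    define f where "f b b' e = cnj (v $ b') * \<Psi> $ ((a, b'), e) * (v $ b * cnj (\<Psi> $ ((a', b), e)))"
      for b b' e
    have "ptrace2 ((mat 1 \<otimes>\<^sub>m ketbra v) ** ptrace2 (ketbra \<Psi>)) $ a $ a' =
        (\<Sum>b\<in>UNIV. \<Sum>b'\<in>UNIV. \<Sum>e\<in>UNIV. f b b' e)"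
      by (simp add: ptrace2_local_mult_nth ptrace2_ketbra_nth sum_distrib_left f_def ketbra_nth
          ac_simps)
    also have "\<dots> = (\<Sum>b'\<in>UNIV. \<Sum>b\<in>UNIV. \<Sum>e\<in>UNIV. f b b' e)"
      by (rule sum.swap)
    also have "\<dots> = (\<Sum>b'\<in>UNIV. \<Sum>e\<in>UNIV. \<Sum>b\<in>UNIV. f b b' e)"
      by (intro sum.cong refl sum.swap)
    also have "\<dots> = (\<Sum>e\<in>UNIV. \<Sum>b'\<in>UNIV. \<Sum>b\<in>UNIV. f b b' e)"
      by (rule sum.swap)
    also have "\<dots> = (branch \<Psi> v ** adj (branch \<Psi> v)) $ a $ a'"
      by (simp add: matrix_matrix_mult_def branch_def sum_product f_def)
    finally show ?thesis .
  qed
  thus ?thesis by (simp add: vec_eq_iff)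
qed

text \<open>The state of E depends on \<open>\<Psi>\<close> only through the reduced operator on E
  and B: it is the partial trace over B of that operator multiplied by \<open>ketbra v\<close> on
  B.\<close>

lemma env_nth:
  "env \<Psi> v $ e $ e' = (\<Sum>b\<in>UNIV. \<Sum>b'\<in>UNIV.
     (v $ b' * cnj (v $ b)) * reduced_EB (ketbra \<Psi>) $ (e, b) $ (e', b'))"
proof -
  define f where "f a b b' = cnj (v $ b) * \<Psi> $ ((a, b), e) * (v $ b' * cnj (\<Psi> $ ((a, b'), e')))"
    for a b b'
  have "env \<Psi> v $ e $ e' = (\<Sum>a\<in>UNIV. \<Sum>b\<in>UNIV. \<Sum>b'\<in>UNIV. f a b b')"
    by (simp add: env_def matrix_matrix_mult_def branch_def transpose_def sum_product f_def)
  also have "\<dots> = (\<Sum>b\<in>UNIV. \<Sum>a\<in>UNIV. \<Sum>b'\<in>UNIV. f a b b')"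
    by (rule sum.swap)
  also have "\<dots> = (\<Sum>b\<in>UNIV. \<Sum>b'\<in>UNIV. \<Sum>a\<in>UNIV. f a b b')"
    by (intro sum.cong refl sum.swap)
  finally show ?thesis
    by (simp add: reduced_EB_def ketbra_def f_def sum_distrib_left ac_simps)
qed

lemma psd_env: "psd (env \<Psi> v)"
  using psd_mult_adj[OF psd_mat_1, of "transpose (branch \<Psi> v)"] by (simp add: env_def)

lemma trace_mult_adj_transpose:
  fixes M :: "complex ^ 'n::finite ^ 'm::finite"
  shows "trace (transpose M ** adj (transpose M)) = trace (M ** adj M)"
  unfolding trace_mult_adj by (subst sum.swap) (simp add: transpose_def)

lemma outcome_prob_ketbra: "outcome_prob (ptrace2 (ketbra \<Psi>)) (ketbra v) = Re (trace (env \<Psi> v))"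
  by (simp add: outcome_prob_eq_trace ptrace2_local_ketbra env_def trace_mult_adj_transpose)

lemma env_eq_0:
  assumes "Re (trace (env \<Psi> v)) = 0"
  shows "env \<Psi> v = 0"
  using trace_mult_adj_eq_0[of "transpose (branch \<Psi> v)"] assms by (simp add: env_def)

lemma vn_entropy_scaled_mult_adj_transpose:
  fixes M :: "complex ^ 'n::finite ^ 'm::finite"
  assumes "r \<ge> 0"
  shows "vn_entropy (r *\<^sub>R (transpose M ** adj (transpose M))) = vn_entropy (r *\<^sub>R (M ** adj M))"
proof -
  \<comment> \<open>The factor \<open>r\<close> is absorbed into the matrix as
    \<open>sqrt r\<close>, so that the unscaled statement applies.\<close>
  have *: "(sqrt r *\<^sub>R A) ** adj (sqrt r *\<^sub>R A) = r *\<^sub>R (A ** adj A)"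
    for A :: "complex ^ 'k::finite ^ 'l::finite"
  proof -
    have sq: "complex_of_real (sqrt r) * (complex_of_real (sqrt r) * z) = of_real r * z" for z
      using assms by (simp add: mult.assoc[symmetric] of_real_mult[symmetric] del: of_real_mult)
    thus ?thesis
      by (simp add: vec_eq_iff matrix_matrix_mult_def scaleR_conv_of_real[of _ "_ :: complex"]
          sum_distrib_left ac_simps sq)
  qed
  have "transpose (sqrt r *\<^sub>R M) = sqrt r *\<^sub>R transpose M"
    by (simp add: vec_eq_iff transpose_def)
  thus ?thesis
    using vn_entropy_mult_adj_transpose[of "sqrt r *\<^sub>R M"] by (simp add: *)
qed

text \<open>After a rank-one outcome the state of the two unmeasured systems is pure.\<close>

lemma vn_entropy_post_state_ketbra:
  "vn_entropy (post_state (ptrace2 (ketbra \<Psi>)) (ketbra v)) =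
    vn_entropy ((1 / Re (trace (env \<Psi> v))) *\<^sub>R env \<Psi> v)"
proof -
  have "1 / Re (trace (env \<Psi> v)) \<ge> 0"
    using trace_psd(2)[OF psd_env] by simp
  from vn_entropy_scaled_mult_adj_transpose[OF this, of "branch \<Psi> v"] show ?thesis
    by (simp add: post_state_def outcome_prob_ketbra ptrace2_local_ketbra env_def)
qed

section \<open>Reduced states of the purification\<close>

lemma reduced_E_nth:
  "reduced_E (ketbra \<Psi>) $ e $ e' = (\<Sum>b\<in>UNIV. reduced_EB (ketbra \<Psi>) $ (e, b) $ (e', b))"
proof -
  have "reduced_E (ketbra \<Psi>) $ e $ e' =
      (\<Sum>a\<in>UNIV. \<Sum>b\<in>UNIV. \<Psi> $ ((a, b), e) * cnj (\<Psi> $ ((a, b), e')))"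
    by (simp add: reduced_E_def ptrace1_def ketbra_def sum.cartesian_product UNIV_Times_UNIV split_def)
  also have "\<dots> = (\<Sum>b\<in>UNIV. \<Sum>a\<in>UNIV. \<Psi> $ ((a, b), e) * cnj (\<Psi> $ ((a, b), e')))"
    by (rule sum.swap)
  finally show ?thesis
    by (simp add: reduced_EB_def ketbra_def)
qed

lemma reduced_B_nth:
  "reduced_B (ketbra \<Psi>) $ b $ b' = (\<Sum>e\<in>UNIV. reduced_EB (ketbra \<Psi>) $ (e, b) $ (e, b'))"
  unfolding reduced_B_def ptrace1_def
  by (simp add: ptrace2_ketbra_nth reduced_EB_def) (subst sum.swap, simp add: ketbra_def)

text \<open>By the spectral decomposition of \<open>H = U ** cdiag d ** adj U\<close>, both sides
  are the partial trace over B of the reduced operator on E and B multiplied by \<open>H\<close> on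
  B.\<close>

lemma sum_env_columns_nth:
  "(\<Sum>j\<in>UNIV. d $ j *\<^sub>R env \<Psi> (column j U)) $ e $ e' = (\<Sum>b\<in>UNIV. \<Sum>b'\<in>UNIV.
     (U ** cdiag d ** adj U) $ b' $ b * reduced_EB (ketbra \<Psi>) $ (e, b) $ (e', b'))"
proof -
  define f where "f j b b' = of_real (d $ j) * (U $ b' $ j * cnj (U $ b $ j)) *
      reduced_EB (ketbra \<Psi>) $ (e, b) $ (e', b')" for j b b'
  have "(\<Sum>j\<in>UNIV. d $ j *\<^sub>R env \<Psi> (column j U)) $ e $ e' = (\<Sum>j\<in>UNIV. \<Sum>b\<in>UNIV. \<Sum>b'\<in>UNIV. f j b b')"
    by (simp add: env_nth column_def f_def scaleR_conv_of_real[of _ "_ :: complex"]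
        sum_distrib_left mult.assoc)
  also have "\<dots> = (\<Sum>b\<in>UNIV. \<Sum>j\<in>UNIV. \<Sum>b'\<in>UNIV. f j b b')"
    by (rule sum.swap)
  also have "\<dots> = (\<Sum>b\<in>UNIV. \<Sum>b'\<in>UNIV. \<Sum>j\<in>UNIV. f j b b')"
    by (intro sum.cong refl sum.swap)
  also have "\<dots> = (\<Sum>b\<in>UNIV. \<Sum>b'\<in>UNIV.
     (U ** cdiag d ** adj U) $ b' $ b * reduced_EB (ketbra \<Psi>) $ (e, b) $ (e', b'))"
    by (simp add: matrix_matrix_mult_def[of "U ** cdiag d"] mult_cdiag_nth sum_distrib_left
        sum_distrib_right f_def ac_simps)
  finally show ?thesis .
qed

lemma sum_env_columns:
  fixes U :: "'b::finite cmat"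
  assumes "unitary_mat U"
  shows "(\<Sum>j\<in>UNIV. env \<Psi> (column j U)) = reduced_E (ketbra \<Psi>)"
proof -
  have "cdiag (\<chi> j. 1) = (mat 1 :: 'b cmat)"
    by (simp add: vec_eq_iff cdiag_def mat_def)
  hence "(\<Sum>j\<in>UNIV. env \<Psi> (column j U)) $ e $ e' = reduced_E (ketbra \<Psi>) $ e $ e'" for e e'
    using sum_env_columns_nth[of "\<chi> j. 1" \<Psi> U e e']
    by (simp add: unitary_matD[OF assms] reduced_E_nth)
       (simp add: mat_def if_distrib[of "\<lambda>x. x * _"] cong: if_cong)
  thus ?thesis by (simp add: vec_eq_iff)
qed

lemma
  fixes \<Psi> :: "complex ^ ('x::finite \<times> 'e::finite)"
  shows ketbra_reduced_entropy: "vn_entropy (ptrace1 (ketbra \<Psi>)) = vn_entropy (ptrace2 (ketbra \<Psi>))"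
    and trace_ptrace1_ketbra: "trace (ptrace1 (ketbra \<Psi>)) = of_real ((norm \<Psi>)\<^sup>2)"
proof -
  \<comment> \<open>Coefficient matrix of \<open>\<Psi>\<close> across the bipartite cut; the
    reduced operators are its two Gram matrices, up to a transpose.\<close>
  define P where "P = (\<chi> x e. \<Psi> $ (x, e))"
  have P: "ptrace2 (ketbra \<Psi>) = P ** adj P"
    by (simp add: vec_eq_iff ptrace2_def ketbra_def matrix_matrix_mult_def P_def)
  have Q: "ptrace1 (ketbra \<Psi>) = transpose P ** adj (transpose P)"
    by (simp add: vec_eq_iff ptrace1_def ketbra_def matrix_matrix_mult_def P_def transpose_def)
  show "vn_entropy (ptrace1 (ketbra \<Psi>)) = vn_entropy (ptrace2 (ketbra \<Psi>))"
    unfolding P Q by (rule vn_entropy_mult_adj_transpose)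
  have "(norm \<Psi>)\<^sup>2 = (\<Sum>i\<in>UNIV. (cmod (\<Psi> $ i))\<^sup>2)"
    by (simp add: norm_vec_def L2_set_def sum_nonneg)
  thus "trace (ptrace1 (ketbra \<Psi>)) = of_real ((norm \<Psi>)\<^sup>2)"
    unfolding Q trace_mult_adj_transpose
    by (simp add: trace_mult_adj P_def sum.cartesian_product UNIV_Times_UNIV split_def)
qed

text \<open>The double sum is Tr(HX), complex linear in \<open>H\<close>. The Hermitian matrices
  \<open>H1\<close> and \<open>H2\<close> are chosen so that \<open>H1\<close> plus
  \<open>\<i>\<close> times \<open>H2\<close> is twice \<open>adj X\<close>, which yields the
  squared Hilbert-Schmidt norm of \<open>X\<close>.\<close>

lemma hermitian_pairing_eq_0:
  fixes X :: "'n::finite cmat"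
  assumes "\<And>H. adj H = H \<Longrightarrow> (\<Sum>b\<in>UNIV. \<Sum>b'\<in>UNIV. H $ b' $ b * X $ b $ b') = 0"
  shows "X = 0"
proof -
  define H1 where "H1 = X + adj X"
  define H2 where "H2 = (\<chi> i j. \<i> * (X $ i $ j - adj X $ i $ j))"
  have "adj H1 = H1" "adj H2 = H2"
    by (simp_all add: vec_eq_iff H1_def H2_def algebra_simps)
  from this[THEN assms]
  have "(\<Sum>b\<in>UNIV. \<Sum>b'\<in>UNIV. H1 $ b' $ b * X $ b $ b')
      + \<i> * (\<Sum>b\<in>UNIV. \<Sum>b'\<in>UNIV. H2 $ b' $ b * X $ b $ b') = 0"
    by simp
  hence "(\<Sum>b\<in>UNIV. \<Sum>b'\<in>UNIV. (H1 $ b' $ b + \<i> * H2 $ b' $ b) * X $ b $ b') = 0"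
    by (simp add: sum_distrib_left sum.distrib[symmetric] algebra_simps)
  moreover have "H1 $ b' $ b + \<i> * H2 $ b' $ b = 2 * cnj (X $ b $ b')" for b b'
    by (simp add: H1_def H2_def mult.assoc[symmetric])
  ultimately have "(\<Sum>b\<in>UNIV. \<Sum>b'\<in>UNIV. X $ b $ b' * cnj (X $ b $ b')) = 0"
    by (simp add: sum_distrib_left[symmetric] mult.assoc mult.commute[of "cnj _"])
  hence "trace (X ** adj X) = 0"
    by (simp add: trace_def matrix_matrix_mult_def)
  thus ?thesis
    by (intro trace_mult_adj_eq_0) simp
qed


section \<open>Consequences of maximal discord\<close>

lemma entropy_average_ge:
  assumes \<rho>: "\<rho> = ptrace2 (ketbra \<Psi>)"
    and disc: "discord \<rho> = vn_entropy (ptrace1 \<rho>)" and U: "unitary_mat U"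
  defines "p \<equiv> \<lambda>j. Re (trace (env \<Psi> (column j U)))"
  shows "vn_entropy \<rho> \<le> (\<Sum>j | p j \<noteq> 0. p j * vn_entropy ((1 / p j) *\<^sub>R env \<Psi> (column j U)))"
proof -
  \<comment> \<open>POVM outcomes are natural numbers below \<open>n\<close>, so the columns of
    \<open>U\<close> are enumerated by a bijection.\<close>
  obtain h :: "nat \<Rightarrow> 'b" where h: "bij_betw h {0..<CARD('b)} UNIV"
    using ex_bij_betw_nat_finite[OF finite] by blast
  hence h': "bij_betw h {..<CARD('b)} UNIV"
    by (simp add: atLeast0LessThan)
  define E where "E i = ketbra (column (h i) U)" for i
  have "povm CARD('b) E"
    using sum.reindex_bij_betw[OF h', of "\<lambda>j. ketbra (column j U)"] sum_ketbra_columns[OF U]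
    by (simp add: povm_def E_def psd_ketbra)
  hence "measured_info \<rho> CARD('b) E \<le> classical_corr \<rho>"
    unfolding \<rho> by (rule measured_info_le_classical_corr)
  also have "\<dots> = vn_entropy (ptrace2 \<rho>) - vn_entropy \<rho>"
    using disc by (simp add: discord_def mutual_info_def)
  finally have "vn_entropy \<rho> \<le> (\<Sum>i | i < CARD('b) \<and> outcome_prob \<rho> (E i) \<noteq> 0.
      outcome_prob \<rho> (E i) * vn_entropy (post_state \<rho> (E i)))"
    by (simp add: measured_info_def)
  also have "\<dots> = (\<Sum>i | i < CARD('b) \<and> p (h i) \<noteq> 0.
      p (h i) * vn_entropy ((1 / p (h i)) *\<^sub>R env \<Psi> (column (h i) U)))"
    unfolding \<rho> E_def outcome_prob_ketbra vn_entropy_post_state_ketbra p_def ..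
  also have "\<dots> = (\<Sum>j | p j \<noteq> 0. p j * vn_entropy ((1 / p j) *\<^sub>R env \<Psi> (column j U)))"
    by (rule sum.reindex_bij_betw, rule bij_betwI', insert h')
      (auto simp: bij_betw_def inj_on_def image_iff set_eq_iff, metis lessThan_iff)
  finally show ?thesis .
qed

text \<open>The unnormalised form covers outcomes of probability zero, where both sides vanish.
  Strict concavity is applied only to the outcomes in \<open>I\<close>, whose normalised states
  exist and still average to the state of E.\<close>

lemma env_eq_of_maximal_discord:
  assumes \<Psi>: "purification \<Psi> \<rho>" and disc: "discord \<rho> = vn_entropy (ptrace1 \<rho>)" and U: "unitary_mat U"
  shows "env \<Psi> (column j U) = Re (trace (env \<Psi> (column j U))) *\<^sub>R reduced_E (ketbra \<Psi>)"
proof -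
  have \<rho>: "\<rho> = ptrace2 (ketbra \<Psi>)" and norm: "norm \<Psi> = 1"
    using \<Psi> by (auto simp: purification_def)
  define p where "p j = Re (trace (env \<Psi> (column j U)))" for j
  define \<tau> where "\<tau> j = (1 / p j) *\<^sub>R env \<Psi> (column j U)" for j
  define I where "I = {j. p j \<noteq> 0}"
  have p0: "env \<Psi> (column j U) = 0" if "j \<notin> I" for j
    using that env_eq_0[of \<Psi> "column j U"] by (simp add: I_def p_def)
  have p\<tau>: "p j *\<^sub>R \<tau> j = env \<Psi> (column j U)" for j
    using p0[of j] by (cases "j \<in> I") (auto simp: I_def \<tau>_def)
  have p_pos: "p j > 0" if "j \<in> I" for j
    using that trace_psd(2)[OF psd_env, of \<Psi> "column j U"] by (simp add: I_def p_def)
  have "(\<Sum>j\<in>I. p j) = (\<Sum>j\<in>UNIV. p j)"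
    by (rule sum.mono_neutral_left) (auto simp: I_def)
  also have "\<dots> = Re (trace (\<Sum>j\<in>UNIV. env \<Psi> (column j U)))"
    by (simp add: p_def trace_def) (rule sum.swap)
  also have "\<dots> = 1"
    by (simp add: sum_env_columns[OF U] reduced_E_def trace_ptrace1_ketbra norm)
  finally have p_sum: "(\<Sum>j\<in>I. p j) = 1" .
  have \<sigma>: "reduced_E (ketbra \<Psi>) = (\<Sum>j\<in>I. p j *\<^sub>R \<tau> j)"
    unfolding sum_env_columns[OF U, symmetric] p\<tau>
    by (rule sum.mono_neutral_right) (auto simp: p0)
  have dens: "density_op (\<tau> j)" if "j \<in> I" for j
    using that density_op_normalise[OF psd_env, of \<Psi> "column j U"] by (simp add: I_def \<tau>_def p_def)
  have le: "vn_entropy (reduced_E (ketbra \<Psi>)) \<le> (\<Sum>j\<in>I. p j * vn_entropy (\<tau> j))"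
    using entropy_average_ge[OF \<rho> disc U]
    unfolding reduced_E_def ketbra_reduced_entropy \<rho> I_def \<tau>_def p_def .
  show ?thesis
  proof (cases "j \<in> I")
    case True
    have "\<tau> j = reduced_E (ketbra \<Psi>)"
      by (rule vn_entropy_strictly_concave[OF _ p_pos p_sum dens \<sigma> le True]) auto
    thus ?thesis using p\<tau>[of j] by (simp add: p_def)
  next
    case False
    thus ?thesis using p0 by (simp add: trace_def)
  qed
qed

theorem mainTheorem5:
  fixes \<rho> :: "('a::finite \<times> 'b::finite) cmat"
    and \<Psi> :: "complex ^ (('a \<times> 'b) \<times> 'e::finite)"
  assumes "density_op \<rho>"
    and "purification \<Psi> \<rho>"
    and "discord \<rho> = vn_entropy (ptrace1 \<rho>)"
  shows "reduced_EB (ketbra \<Psi>) = reduced_E (ketbra \<Psi>) \<otimes>\<^sub>m reduced_B (ketbra \<Psi>)"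
proof -
  let ?R = "reduced_EB (ketbra \<Psi>)" and ?E = "reduced_E (ketbra \<Psi>)" and ?B = "reduced_B (ketbra \<Psi>)"
  \<comment> \<open>Fixing \<open>e\<close> and \<open>e'\<close> leaves a matrix on B, in general
    not Hermitian, which is tested against Hermitian \<open>H\<close>.\<close>
  have "(\<chi> b b'. ?R $ (e, b) $ (e', b') - ?E $ e $ e' * ?B $ b $ b') = 0" for e e'
  proof (rule hermitian_pairing_eq_0)
    fix H :: "'b cmat"
    assume "adj H = H"
    then obtain U d where U: "unitary_mat U" "H = U ** cdiag d ** adj U"
      by (rule hermitian_diagonalisation)
    define c where "c = (\<Sum>j\<in>UNIV. d $ j * Re (trace (env \<Psi> (column j U))))"
    have *: "(\<Sum>b\<in>UNIV. \<Sum>b'\<in>UNIV. H $ b' $ b * ?R $ (x, b) $ (y, b')) = of_real c * ?E $ x $ y" for x y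
    proof -
      have "(\<Sum>j\<in>UNIV. d $ j *\<^sub>R env \<Psi> (column j U)) = c *\<^sub>R ?E"
        by (subst env_eq_of_maximal_discord[OF assms(2,3) U(1)])
          (simp add: c_def scaleR_sum_left)
      thus ?thesis
        unfolding U(2) sum_env_columns_nth[symmetric]
        by (simp add: scaleR_conv_of_real[of _ "_ :: complex"])
    qed
    \<comment> \<open>Taking the trace over E in \<open>*\<close> identifies the constant
      \<open>c\<close> as the expectation of \<open>H\<close> in the state of B.\<close>
    have "trace ?E = 1"
      using assms(2) by (simp add: reduced_E_def trace_ptrace1_ketbra purification_def)
    hence "of_real c = (\<Sum>x\<in>UNIV. \<Sum>b\<in>UNIV. \<Sum>b'\<in>UNIV. H $ b' $ b * ?R $ (x, b) $ (x, b'))"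
      by (simp add: * sum_distrib_left[symmetric] trace_def)
    also have "\<dots> = (\<Sum>b\<in>UNIV. \<Sum>x\<in>UNIV. \<Sum>b'\<in>UNIV. H $ b' $ b * ?R $ (x, b) $ (x, b'))"
      by (rule sum.swap)
    also have "\<dots> = (\<Sum>b\<in>UNIV. \<Sum>b'\<in>UNIV. \<Sum>x\<in>UNIV. H $ b' $ b * ?R $ (x, b) $ (x, b'))"
      by (intro sum.cong refl sum.swap)
    also have "\<dots> = (\<Sum>b\<in>UNIV. \<Sum>b'\<in>UNIV. H $ b' $ b * ?B $ b $ b')"
      by (simp add: reduced_B_nth sum_distrib_left)
    finally have "of_real c * ?E $ e $ e' =
        (\<Sum>b\<in>UNIV. \<Sum>b'\<in>UNIV. H $ b' $ b * (?E $ e $ e' * ?B $ b $ b'))"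
      by (simp add: sum_distrib_left sum_distrib_right ac_simps)
    with *[of e e'] show "(\<Sum>b\<in>UNIV. \<Sum>b'\<in>UNIV. H $ b' $ b *
        (\<chi> b b'. ?R $ (e, b) $ (e', b') - ?E $ e $ e' * ?B $ b $ b') $ b $ b') = 0"
      by (simp add: right_diff_distrib sum_subtractf)
  qed
  thus ?thesis
    by (simp add: vec_eq_iff tensor_def)
qed


end
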